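(* Let $Q=(q_{ij})_{1\le i,j\le N}$ be an irreducible transition rate matrix. There exists a constant $c_4>0$, depending only on $Q$, such that for every solution $p(t)=(p_1(t),\dots,p_N(t))$ of the master equation $\frac{dp}{dt}=pQ$ starting from a probability distribution $p(0)$, and every $t\ge0$, writing $p_i=p_i(t)$, the entropy production rate $$e_p=\frac12\sum_{i,j}(p_iq_{ij}-p_jq_{ji})\log\frac{p_iq_{ij}}{p_jq_{ji}}\in[0,+\infty]$$ satisfies $$e_p \;\ge\; c_4\sum_{i,j}(p_iq_{ij}-p_jq_{ji})^2 .$$
   Context: Transition rate matrix on the finite state space $\{1,\dots,N\}$: a real matrix $Q=(q_{ij})$ with $q_{ij}\ge 0$ for $i\ne j$ and $q_{ii}=-\sum_{j\ne i}q_{ij}$. Irreducible: for each pair of states $i\neq j$ there is a sequence of states $i_1=i,i_2,\dots,i_m=j$ with $q_{i_1i_2}q_{i_2i_3}\cdots q_{i_{m-1}i_m}>0$. For any initial probability distribution $p(0)$, the solution $p(t)$ (a row vector) of $dp/dt=pQ$ is a probability distribution for all $t\ge 0$, and all its components are positive for $t>0$. Conventions in the definition of $e_p$: $0/0=1$ inside the logarithm; $\log(a/0)=+\infty$ and $\log 0=-\infty$ for $a>0$. Thus for $i\neq j$ the summand is $+\infty$ when exactly one of $p_iq_{ij}$, $p_jq_{ji}$ is zero, and an infinite value of $e_p$ is allowed (the inequality is then trivially true). The diagonal terms $i=j$ are zero. *)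

theory Defs
  imports "HOL-Analysis.Analysis"
begin

text \<open>
  The state space is a finite type in place of \<open>{1,\<dots>,N}\<close>; the rate from state \<open>i\<close> to
  state \<open>j\<close> is \<open>Q $ i $ j\<close>, and \<open>p v* Q\<close> is the row vector \<open>pQ\<close>.
\<close>

definition transition_rate_matrix :: "real^'n^'n \<Rightarrow> bool" where
  "transition_rate_matrix Q \<longleftrightarrow>
     (\<forall>i j. i \<noteq> j \<longrightarrow> 0 \<le> Q $ i $ j) \<and>
     (\<forall>i. Q $ i $ i = - (\<Sum>j\<in>UNIV - {i}. Q $ i $ j))"

definition irreducible_rates :: "real^'n^'n \<Rightarrow> bool" where
  "irreducible_rates Q \<longleftrightarrow>
     (\<forall>i j. i \<noteq> j \<longrightarrow>
        (\<exists>s. s \<noteq> [] \<and> hd s = i \<and> last s = j \<and>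
             (\<Prod>k<length s - 1. Q $ (s ! k) $ (s ! Suc k)) > 0))"

definition probability_distribution :: "real^'n \<Rightarrow> bool" where
  "probability_distribution p \<longleftrightarrow> (\<forall>i. 0 \<le> p $ i) \<and> (\<Sum>i\<in>UNIV. p $ i) = 1"

definition solves_master_equation :: "real^'n^'n \<Rightarrow> (real \<Rightarrow> real^'n) \<Rightarrow> bool" where
  "solves_master_equation Q p \<longleftrightarrow>
     (\<forall>t\<ge>0. (p has_vector_derivative (p t v* Q)) (at t within {0..}))"

text \<open>
  \<open>log_ratio a b\<close> is \<open>log (a/b)\<close> as an extended real, with the conventions \<open>0/0 = 1\<close>,
  \<open>log (a/0) = +\<infinity>\<close> and \<open>log 0 = -\<infinity>\<close>.  It is meant for \<open>a\<close> and \<open>b\<close> both nonnegative or both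
  nonpositive; the latter occurs on the diagonal of the entropy production rate, where \<open>a = b\<close>.
\<close>

definition log_ratio :: "real \<Rightarrow> real \<Rightarrow> ereal" where
  "log_ratio a b =
     (if a = 0 \<and> b = 0 then 0
      else if b = 0 then \<infinity>
      else if a = 0 then -\<infinity>
      else ereal (ln (a / b)))"

text \<open>
  For a rate matrix \<open>Q\<close> and nonnegative \<open>p\<close> all summands below are nonnegative, so the
  extended-real sum never involves \<open>\<infinity> - \<infinity>\<close>.
\<close>

definition entropy_production_rate :: "real^'n^'n \<Rightarrow> real^'n \<Rightarrow> ereal" where
  "entropy_production_rate Q p =
     ereal (1/2) * (\<Sum>i\<in>UNIV. \<Sum>j\<in>UNIV.
       ereal (p $ i * Q $ i $ j - p $ j * Q $ j $ i) *
       log_ratio (p $ i * Q $ i $ j) (p $ j * Q $ j $ i))"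

lemma log_ratio_self [simp]: "log_ratio a a = 0"
  by (simp add: log_ratio_def)

lemma entropy_production_summand_nonneg:
  assumes "0 \<le> a" "0 \<le> b"
  shows "0 \<le> ereal (a - b) * log_ratio a b"
proof -
  consider "a = 0" "b = 0" | "a = 0" "b > 0" | "a > 0" "b = 0" | "a > 0" "b > 0"
    using assms by linarith
  then show ?thesis
  proof cases
    case 4
    have "0 \<le> (a - b) * ln (a / b)"
    proof (cases "a \<ge> b")
      case True
      then show ?thesis using 4 by simp
    next
      case False
      then have "ln (a / b) \<le> 0" using 4 by simp
      then show ?thesis using False by (intro mult_nonpos_nonpos) auto
    qed
    then show ?thesis using 4 by (simp add: log_ratio_def)
  qed (simp_all add: log_ratio_def)
qed

lemma entropy_production_summand_infinite:
  assumes "0 \<le> a" "0 \<le> b" "(a = 0) \<noteq> (b = 0)"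
  shows "ereal (a - b) * log_ratio a b = \<infinity>"
  using assms by (auto simp: log_ratio_def)

end

theory Submission
  imports Defs
begin

text \<open>
  A solution of the master equation stays in the probability simplex: total mass is conserved, and
  the sum of the squared negative parts satisfies a Gronwall inequality, so it remains zero.
  Hence every flux \<open>p\<^sub>i q\<^sub>i\<^sub>j\<close> with \<open>i \<noteq> j\<close> lies in \<open>[0, K]\<close> with \<open>K\<close> depending only on \<open>Q\<close>, and
  \<open>ln x \<le> x - 1\<close> gives \<open>(a - b) ln (a / b) \<ge> (a - b)\<^sup>2 / max a b \<ge> (a - b)\<^sup>2 / K\<close>.
\<close>

text \<open>Squaring removes the kink of \<open>min y 0\<close> at zero: the first-order Taylor
  remainder is at most \<open>(y - x)\<^sup>2\<close> for all signs of \<open>x\<close> and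
  \<open>y\<close>. This makes the squared negative part of a solution differentiable at every time,
  including zeros of a component.\<close>

lemma DERIV_min_0_squared:
  "((\<lambda>y. (min y 0)\<^sup>2) has_real_derivative 2 * min x 0) (at x)"
proof -
  have quot: "norm (((min y 0)\<^sup>2 - (min x 0)\<^sup>2) / (y - x) - 2 * min x 0) \<le> \<bar>y - x\<bar>"
    if "y \<noteq> x" for y :: real
  proof -
    have "\<bar>(min y 0)\<^sup>2 - (min x 0)\<^sup>2 - 2 * min x 0 * (y - x)\<bar> \<le> (y - x)\<^sup>2"
    proof -
      consider "x \<ge> 0" "y \<ge> 0" | "x \<ge> 0" "y < 0" | "x < 0" "y \<ge> 0" | "x < 0" "y < 0"
        by linarith
      then show ?thesis
      proof cases
        case 2
        then have "y\<^sup>2 \<le> (y - x)\<^sup>2"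
          by (intro iffD1[OF abs_le_square_iff]) auto
        then show ?thesis using 2 by simp
      next
        case 3
        \<comment> \<open>The remainder equals \<open>x\<^sup>2 - 2 * (x * y)\<close>, which is
          nonnegative because \<open>x\<close> and \<open>y\<close> have opposite signs, and falls
          short of \<open>(y - x)\<^sup>2\<close> by exactly \<open>y\<^sup>2\<close>.\<close>
        then have "x * y \<le> 0" by (intro mult_nonpos_nonneg) auto
        moreover have "- (x\<^sup>2) - 2 * x * (y - x) = x\<^sup>2 - 2 * (x * y)"
          and "(y - x)\<^sup>2 = y\<^sup>2 + x\<^sup>2 - 2 * (x * y)"
          by (simp_all add: algebra_simps power2_eq_square)
        moreover have "(min y 0)\<^sup>2 - (min x 0)\<^sup>2 - 2 * min x 0 * (y - x) = - (x\<^sup>2) - 2 * x * (y - x)"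
          using 3 by simp
        ultimately show ?thesis
          using zero_le_power2[of x] zero_le_power2[of y] by linarith
      next
        case 4
        have "y\<^sup>2 - x\<^sup>2 - 2 * x * (y - x) = (y - x)\<^sup>2"
          by (simp add: algebra_simps power2_eq_square)
        then show ?thesis using 4 by simp
      qed simp
    qed
    then have "\<bar>(min y 0)\<^sup>2 - (min x 0)\<^sup>2 - 2 * min x 0 * (y - x)\<bar> / \<bar>y - x\<bar> \<le> \<bar>y - x\<bar>"
      using that by (simp add: divide_le_eq power2_eq_square flip: abs_mult)
    moreover have "((min y 0)\<^sup>2 - (min x 0)\<^sup>2) / (y - x) - 2 * min x 0
        = ((min y 0)\<^sup>2 - (min x 0)\<^sup>2 - 2 * min x 0 * (y - x)) / (y - x)"
      using that by (simp add: diff_divide_distrib)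
    ultimately show ?thesis
      by (simp add: abs_divide)
  qed
  have "((\<lambda>y. ((min y 0)\<^sup>2 - (min x 0)\<^sup>2) / (y - x) - 2 * min x 0) \<longlongrightarrow> 0) (at x)"
  proof (rule Lim_null_comparison)
    show "\<forall>\<^sub>F y in at x. norm (((min y 0)\<^sup>2 - (min x 0)\<^sup>2) / (y - x) - 2 * min x 0) \<le> \<bar>y - x\<bar>"
      unfolding eventually_at_filter by (intro always_eventually) (use quot in blast)
    have "((\<lambda>y. \<bar>y - x\<bar>) \<longlongrightarrow> \<bar>x - x\<bar>) (at x)"
      by (intro tendsto_intros)
    then show "((\<lambda>y. \<bar>y - x\<bar>) \<longlongrightarrow> 0) (at x)" by simp
  qed
  then show ?thesis
    unfolding has_field_derivative_iff by (subst Lim_null)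
qed

lemma rate_nonneg:
  "transition_rate_matrix Q \<Longrightarrow> i \<noteq> j \<Longrightarrow> 0 \<le> Q $ i $ j"
  by (simp add: transition_rate_matrix_def)

lemma rate_row_sum:
  assumes "transition_rate_matrix Q"
  shows "(\<Sum>j\<in>UNIV. Q $ i $ j) = 0"
  using assms by (simp add: transition_rate_matrix_def sum.remove[of UNIV i])

lemma abs_entry_le_sum:
  fixes Q :: "real^'n^'m"
  shows "\<bar>Q $ i $ j\<bar> \<le> (\<Sum>i\<in>UNIV. \<Sum>j\<in>UNIV. \<bar>Q $ i $ j\<bar>)"
proof -
  have "\<bar>Q $ i $ j\<bar> \<le> (\<Sum>j\<in>UNIV. \<bar>Q $ i $ j\<bar>)"
    by (intro member_le_sum) auto
  also have "\<dots> \<le> (\<Sum>i\<in>UNIV. \<Sum>j\<in>UNIV. \<bar>Q $ i $ j\<bar>)"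
    by (rule member_le_sum[where f = "\<lambda>i. \<Sum>j\<in>UNIV. \<bar>Q $ i $ j\<bar>"]) (auto intro: sum_nonneg)
  finally show ?thesis .
qed

lemma master_equation_component:
  assumes "solves_master_equation Q p" "t \<ge> 0"
  shows "((\<lambda>t. p t $ i) has_real_derivative (\<Sum>j\<in>UNIV. p t $ j * Q $ j $ i)) (at t within {0..})"
proof -
  have "(p has_vector_derivative (p t v* Q)) (at t within {0..})"
    using assms by (simp add: solves_master_equation_def)
  then have "((\<lambda>t. p t $ i) has_vector_derivative (p t v* Q) $ i) (at t within {0..})"
    by (rule bounded_linear.has_vector_derivative[OF bounded_linear_vec_nth])
  then show ?thesis
    by (simp add: has_real_derivative_iff_has_vector_derivative vector_matrix_mult_def mult.commute)
qed

text \<open>Swapping the two sums turns the derivative of the total mass into the row sums of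
  \<open>Q\<close> weighted by the components of \<open>p\<close>, and the row sums vanish.\<close>

lemma master_equation_mass:
  assumes Q: "transition_rate_matrix Q" and p: "solves_master_equation Q p" and t: "t \<ge> 0"
  shows "(\<Sum>i\<in>UNIV. p t $ i) = (\<Sum>i\<in>UNIV. p 0 $ i)"
proof -
  have "((\<lambda>t. \<Sum>i\<in>UNIV. p t $ i) has_real_derivative 0) (at s within {0..})" if "s \<in> {0..}" for s
  proof -
    have "((\<lambda>t. \<Sum>i\<in>UNIV. p t $ i) has_real_derivative (\<Sum>i\<in>UNIV. \<Sum>j\<in>UNIV. p s $ j * Q $ j $ i))
        (at s within {0..})"
      using that by (intro DERIV_sum master_equation_component[OF p]) auto
    moreover have "(\<Sum>i\<in>UNIV. \<Sum>j\<in>UNIV. p s $ j * Q $ j $ i) = 0"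
      by (subst sum.swap) (simp add: rate_row_sum[OF Q] flip: sum_distrib_left)
    ultimately show ?thesis by simp
  qed
  then obtain c where "\<forall>s\<in>{0..}. (\<Sum>i\<in>UNIV. p s $ i) = c"
    using has_field_derivative_zero_constant[of "{0::real..}" "\<lambda>t. \<Sum>i\<in>UNIV. p t $ i"] by auto
  then show ?thesis using t by simp
qed

text \<open>Off-diagonal rates are nonnegative, so a nonnegative component can only push the others
  up. Growth of the negative parts is therefore driven by the negative parts alone, and these are
  zero at time 0.\<close>

lemma master_equation_nonneg:
  fixes Q :: "real^'n^'n"
  assumes Q: "transition_rate_matrix Q" and p: "solves_master_equation Q p"
    and p0: "\<And>i. 0 \<le> p 0 $ i" and t: "t \<ge> 0"
  shows "0 \<le> p t $ i"
proof -
  define K where "K = (\<Sum>i\<in>UNIV. \<Sum>j\<in>UNIV. \<bar>Q $ i $ j\<bar>)"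
  define n where "n s i = min (p s $ i) 0" for s i
  define f where "f s = (\<Sum>i\<in>UNIV. (n s i)\<^sup>2)" for s
  define f' where "f' s = (\<Sum>i\<in>UNIV. 2 * n s i * (\<Sum>j\<in>UNIV. p s $ j * Q $ j $ i))" for s
  \<comment> \<open>Summing \<open>K * ((n s i)\<^sup>2 + (n s j)\<^sup>2)\<close> over all pairs
    counts each square twice per state, hence the factor \<open>2 * CARD('n)\<close>.\<close>
  define C where "C = 2 * K * real CARD('n)"
  have deriv_f: "(f has_real_derivative f' s) (at s within {0..})" if "s \<ge> 0" for s
    unfolding f_def f'_def n_def
    using that by (intro DERIV_sum DERIV_chain2[OF DERIV_min_0_squared] master_equation_component[OF p])
  have f'_le: "f' s \<le> C * f s" for s
  proof -
    have summand: "2 * n s i * (p s $ j * Q $ j $ i) \<le> K * ((n s i)\<^sup>2 + (n s j)\<^sup>2)" for i j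
    proof -
      \<comment> \<open>Off the diagonal, replacing \<open>p s $ j\<close> by the smaller
        \<open>n s j\<close> increases the product, since \<open>n s i \<le> 0\<close> and the rate
        is nonnegative. On the diagonal the rate has the wrong sign, but there both sides
        agree.\<close>
      have "n s i * p s $ j * Q $ j $ i \<le> n s i * n s j * Q $ j $ i"
      proof (cases "i = j")
        case True
        then show ?thesis by (simp add: n_def min_def)
      next
        case False
        then have "0 \<le> Q $ j $ i" using rate_nonneg[OF Q] by metis
        moreover have "n s i * p s $ j \<le> n s i * n s j"
          by (intro mult_left_mono_neg) (auto simp: n_def)
        ultimately show ?thesis by (rule mult_right_mono[rotated])
      qed
      also have "\<dots> \<le> \<bar>n s i * n s j\<bar> * \<bar>Q $ j $ i\<bar>"
        by (metis abs_ge_self abs_mult)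
      also have "\<dots> \<le> \<bar>n s i * n s j\<bar> * K"
        unfolding K_def by (intro mult_left_mono abs_entry_le_sum) auto
      finally have "2 * (n s i * p s $ j * Q $ j $ i) \<le> K * (2 * \<bar>n s i * n s j\<bar>)"
        by (simp add: mult.commute)
      also have "\<dots> \<le> K * ((n s i)\<^sup>2 + (n s j)\<^sup>2)"
      proof (intro mult_left_mono)
        show "2 * \<bar>n s i * n s j\<bar> \<le> (n s i)\<^sup>2 + (n s j)\<^sup>2"
          using sum_squares_bound[of "\<bar>n s i\<bar>" "\<bar>n s j\<bar>"] by (simp add: abs_mult mult.assoc)
        show "0 \<le> K" unfolding K_def by (intro sum_nonneg) auto
      qed
      finally show ?thesis by (simp add: mult.assoc)
    qed
    have "f' s = (\<Sum>i\<in>UNIV. \<Sum>j\<in>UNIV. 2 * n s i * (p s $ j * Q $ j $ i))"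
      by (simp add: f'_def sum_distrib_left)
    also have "\<dots> \<le> (\<Sum>i\<in>UNIV. \<Sum>j\<in>UNIV. K * ((n s i)\<^sup>2 + (n s j)\<^sup>2))"
      by (intro sum_mono summand)
    also have "\<dots> = C * f s"
      by (simp add: C_def f_def sum.distrib algebra_simps sum_distrib_left)
    finally show ?thesis .
  qed
  \<comment> \<open>The integrating factor turns \<open>f' s \<le> C * f s\<close> into monotonicity
    of \<open>g\<close>.\<close>
  define g where "g s = exp (- C * s) * f s" for s
  have deriv_g: "(g has_real_derivative exp (- C * s) * (f' s - C * f s)) (at s within {0..})"
    if "s \<ge> 0" for s
    unfolding g_def
    by (rule derivative_eq_intros deriv_f[OF that] refl)+ (simp add: algebra_simps)
  \<comment> \<open>The derivative at 0 is only one-sided, so two-sided derivatives are used on the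
    open interval and continuity at its endpoints.\<close>
  have "g t \<le> g 0"
  proof (rule DERIV_nonpos_imp_decreasing_open[OF t])
    fix s :: real assume s: "0 < s" "s < t"
    then have "at s within {0..} = at s"
      by (intro at_within_interior) simp
    then have "(g has_real_derivative exp (- C * s) * (f' s - C * f s)) (at s)"
      using deriv_g[of s] s by simp
    moreover have "exp (- C * s) * (f' s - C * f s) \<le> 0"
      using f'_le[of s] by (intro mult_nonneg_nonpos) auto
    ultimately show "\<exists>y. (g has_real_derivative y) (at s) \<and> y \<le> 0" by blast
  next
    have "continuous_on {0..} g"
      by (rule DERIV_continuous_on, rule deriv_g) simp
    then show "continuous_on {0..t} g"
      by (rule continuous_on_subset) auto
  qed
  also have "g 0 = 0" using p0 by (simp add: g_def f_def n_def)
  finally have "f t \<le> 0" by (simp add: g_def mult_le_0_iff)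
  moreover have "(n t i)\<^sup>2 \<le> f t"
    unfolding f_def by (intro member_le_sum) auto
  ultimately have "n t i = 0" by (metis order_trans power2_less_eq_zero_iff)
  then show ?thesis by (simp add: n_def min_def split: if_splits)
qed

lemma probability_distribution_invariant:
  assumes "transition_rate_matrix Q" "solves_master_equation Q p"
    and "probability_distribution (p 0)" "t \<ge> 0"
  shows "probability_distribution (p t)"
  using assms master_equation_nonneg[of Q p] master_equation_mass[of Q p t]
  by (simp add: probability_distribution_def)

text \<open>If exactly one flux vanishes, the right-hand side is infinite; otherwise the bound is
  \<open>ln z \<le> z - 1\<close> with \<open>z\<close> the smaller flux divided by the larger
  one.\<close>

lemma entropy_production_summand_ge:
  assumes ab: "0 \<le> a" "a \<le> K" "0 \<le> b" "b \<le> K" and K: "0 < K"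
  shows "ereal ((a - b)\<^sup>2 / K) \<le> ereal (a - b) * log_ratio a b"
proof -
  consider "a = 0" "b = 0" | "(a = 0) \<noteq> (b = 0)" | "a > 0" "b > 0"
    using ab by linarith
  then show ?thesis
  proof cases
    case 2
    show ?thesis
      unfolding entropy_production_summand_infinite[OF ab(1,3) 2] by simp
  next
    case 3
    \<comment> \<open>Ordering the arguments loses nothing: exchanging them flips the sign of both
      the difference and the logarithm.\<close>
    have *: "(x - y)\<^sup>2 / K \<le> (x - y) * ln (x / y)" if "0 < y" "y \<le> x" "x \<le> K" for x y
    proof -
      have "(x - y)\<^sup>2 / K \<le> (x - y)\<^sup>2 / x"
        using that by (intro divide_left_mono) auto
      also have "\<dots> = (x - y) * (1 - y / x)"
        using that by (simp add: power2_eq_square field_simps)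
      also have "\<dots> \<le> (x - y) * ln (x / y)"
        using that ln_le_minus_one[of "y / x"] by (intro mult_left_mono) (auto simp: ln_div)
      finally show ?thesis .
    qed
    have "(a - b)\<^sup>2 / K \<le> (a - b) * ln (a / b)"
    proof (cases "b \<le> a")
      case True
      then show ?thesis using * ab 3 by simp
    next
      case False
      then have "(b - a)\<^sup>2 / K \<le> (b - a) * ln (b / a)" using * ab 3 by simp
      then show ?thesis using 3 by (simp add: ln_div power2_commute algebra_simps)
    qed
    then show ?thesis using 3 by (simp add: log_ratio_def)
  qed (simp add: log_ratio_def)
qed

theorem theorem3p12:
  fixes Q :: "real^'n^'n"
  assumes "transition_rate_matrix Q" and "irreducible_rates Q"
  shows "\<exists>c4>0. \<forall>p. solves_master_equation Q p \<and> probability_distribution (p 0) \<longrightarrow>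
           (\<forall>t\<ge>0. entropy_production_rate Q (p t) \<ge>
              ereal (c4 * (\<Sum>i\<in>UNIV. \<Sum>j\<in>UNIV. (p t $ i * Q $ i $ j - p t $ j * Q $ j $ i)\<^sup>2)))"
proof -
  \<comment> \<open>The added 1 keeps \<open>K\<close> positive even when \<open>Q\<close> is zero,
    as for a single state.\<close>
  define K where "K = 1 + (\<Sum>i\<in>UNIV. \<Sum>j\<in>UNIV. \<bar>Q $ i $ j\<bar>)"
  have K: "K > 0"
    unfolding K_def by (intro add_pos_nonneg sum_nonneg) auto
  \<comment> \<open>The estimate is static: it holds for every distribution \<open>x\<close>, and
    time enters only through invariance of the simplex. The constant combines \<open>1 / K\<close>
    from each summand with the prefactor \<open>1/2\<close> of the entropy production rate.\<close>
  have main: "ereal (1 / (2 * K) *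
      (\<Sum>i\<in>UNIV. \<Sum>j\<in>UNIV. (x $ i * Q $ i $ j - x $ j * Q $ j $ i)\<^sup>2)) \<le> entropy_production_rate Q x"
    if x: "probability_distribution x" for x :: "real^'n"
  proof -
    have x0: "0 \<le> x $ i" for i
      using x by (simp add: probability_distribution_def)
    have x1: "x $ i \<le> 1" for i
      using x member_le_sum[of i UNIV "\<lambda>i. x $ i"] by (simp add: probability_distribution_def)
    \<comment> \<open>Diagonal entries of \<open>Q\<close> are nonpositive, so the diagonal is
      excluded here; its summands are zero on both sides of the estimate.\<close>
    have flux: "0 \<le> x $ i * Q $ i $ j" "x $ i * Q $ i $ j \<le> K" if "i \<noteq> j" for i j
    proof -
      show "0 \<le> x $ i * Q $ i $ j"
        using x0 rate_nonneg[OF assms(1) that] by simp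
      have "x $ i * Q $ i $ j \<le> Q $ i $ j"
        using x0 x1 rate_nonneg[OF assms(1) that] by (simp add: mult_left_le_one_le)
      also have "\<dots> \<le> K"
        using abs_entry_le_sum[of Q i j] unfolding K_def by linarith
      finally show "x $ i * Q $ i $ j \<le> K" .
    qed
    have "ereal ((x $ i * Q $ i $ j - x $ j * Q $ j $ i)\<^sup>2 / K)
        \<le> ereal (x $ i * Q $ i $ j - x $ j * Q $ j $ i)
          * log_ratio (x $ i * Q $ i $ j) (x $ j * Q $ j $ i)" for i j
    proof (cases "i = j")
      case False
      then show ?thesis using flux K by (intro entropy_production_summand_ge) auto
    qed simp
    then have "ereal (\<Sum>i\<in>UNIV. \<Sum>j\<in>UNIV. (x $ i * Q $ i $ j - x $ j * Q $ j $ i)\<^sup>2 / K)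
        \<le> (\<Sum>i\<in>UNIV. \<Sum>j\<in>UNIV. ereal (x $ i * Q $ i $ j - x $ j * Q $ j $ i)
          * log_ratio (x $ i * Q $ i $ j) (x $ j * Q $ j $ i))"
      unfolding sum_ereal[symmetric] by (intro sum_mono)
    then have "ereal (1/2) * ereal (\<Sum>i\<in>UNIV. \<Sum>j\<in>UNIV. (x $ i * Q $ i $ j - x $ j * Q $ j $ i)\<^sup>2 / K)
        \<le> entropy_production_rate Q x"
      unfolding entropy_production_rate_def by (intro ereal_mult_left_mono) auto
    then show ?thesis
      by (simp flip: sum_divide_distrib)
  qed
  show ?thesis
  proof (intro exI[of _ "1 / (2 * K)"] conjI allI impI)
    show "1 / (2 * K) > 0" using K by simp
  qed (use main probability_distribution_invariant[OF assms(1)] in blast)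
qed

end
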